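(* Let $X$ be a Tychonoff space and let $U$ be an open subspace of $X$. If $X$ is Ascoli, then $U$ is Ascoli. If $X$ is sequentially Ascoli, then $U$ is sequentially Ascoli.
   Context: All spaces are assumed to be Tychonoff. $C_k(X)$ denotes the space $C(X)$ of all continuous real-valued functions on $X$ with the compact-open topology. A subset $H\subseteq C(X)$ is equicontinuous if for every $x\in X$ and each $\varepsilon>0$ there is an open neighborhood $V$ of $x$ such that $|f(x')-f(x)|<\varepsilon$ for all $x'\in V$ and $f\in H$. A Tychonoff space $X$ is Ascoli if every compact subset $\mathcal{K}$ of $C_k(X)$ is evenly continuous, i.e. the map $X\times\mathcal{K}\ni(x,f)\mapsto f(x)$ is continuous (equivalently, every compact subset of $C_k(X)$ is equicontinuous). A Tychonoff space $X$ is sequentially Ascoli if every convergent sequence in $C_k(X)$ is equicontinuous. *)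

theory Defs
  imports "HOL-Analysis.Analysis"
begin

definition Tychonoff_space :: "'a topology \<Rightarrow> bool" where
  "Tychonoff_space X \<longleftrightarrow> completely_regular_space X \<and> Hausdorff_space X"

(* Restricting to extensional functions (value undefined outside topspace X) makes the elements of
   this set correspond one-to-one to the continuous functions on the space X, so that C_k(X) below
   does not contain copies of the same function differing only off the space. *)
definition cont_funs :: "'a topology \<Rightarrow> ('a \<Rightarrow> real) set" where
  "cont_funs X = {f. continuous_map X euclideanreal f} \<inter> extensional (topspace X)"

definition Ck :: "'a topology \<Rightarrow> ('a \<Rightarrow> real) topology" where
  "Ck X = topology_generated_by
     {{f \<in> cont_funs X. f ` K \<subseteq> W} | K W. compactin X K \<and> open W}"

lemma topspace_Ck: "topspace (Ck X) = cont_funs X"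
proof -
  have "cont_funs X = {f \<in> cont_funs X. f ` {} \<subseteq> (UNIV :: real set)}"
    by auto
  moreover have "compactin X {}"
    by simp
  ultimately show ?thesis
    unfolding Ck_def topology_generated_by_topspace by blast
qed

definition equicontinuous_in :: "'a topology \<Rightarrow> ('a \<Rightarrow> real) set \<Rightarrow> bool" where
  "equicontinuous_in X H \<longleftrightarrow>
     (\<forall>x\<in>topspace X. \<forall>\<epsilon>>0. \<exists>V. openin X V \<and> x \<in> V \<and>
        (\<forall>x'\<in>V. \<forall>f\<in>H. \<bar>f x' - f x\<bar> < \<epsilon>))"

definition evenly_continuous_in :: "'a topology \<Rightarrow> ('a \<Rightarrow> real) set \<Rightarrow> bool" where
  "evenly_continuous_in X \<K> \<longleftrightarrow>
     continuous_map (prod_topology X (subtopology (Ck X) \<K>)) euclideanreal (\<lambda>(x, f). f x)"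

definition Ascoli_space :: "'a topology \<Rightarrow> bool" where
  "Ascoli_space X \<longleftrightarrow> Tychonoff_space X \<and>
     (\<forall>\<K>. compactin (Ck X) \<K> \<longrightarrow> evenly_continuous_in X \<K>)"

(* limitin only constrains the tail of the sequence, so membership of every term in C(X) is
   required separately. *)
definition sequentially_Ascoli_space :: "'a topology \<Rightarrow> bool" where
  "sequentially_Ascoli_space X \<longleftrightarrow> Tychonoff_space X \<and>
     (\<forall>f g. range f \<subseteq> cont_funs X \<and> limitin (Ck X) f g sequentially
        \<longrightarrow> equicontinuous_in X (range f))"

end

theory Submission
  imports Defs
begin

text \<open>
  Near a point of \<open>U\<close> choose a continuous cutoff \<open>g : X \<rightarrow> [0,1]\<close> that is \<open>1\<close> near the point and
  vanishes off a closed set \<open>F \<subseteq> U\<close>. Extending \<open>g \<cdot> f\<close> by zero is a map \<open>C\<^sub>k(U) \<rightarrow> C\<^sub>k(X)\<close>, and it is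
  continuous because \<open>K \<inter> F\<close> is a compact subset of \<open>U\<close> for every compact \<open>K \<subseteq> X\<close>. It carries compact
  sets and convergent sequences to such, and does not change values near the point, so even
  continuity and equicontinuity can be read off in \<open>X\<close>.
\<close>

lemma Tychonoff_space_subtopology:
  "Tychonoff_space X \<Longrightarrow> Tychonoff_space (subtopology X S)"
  by (simp add: Tychonoff_space_def completely_regular_space_subtopology Hausdorff_space_subtopology)

lemma openin_Ck_subbasic:
  assumes "compactin X K" "open W"
  shows "openin (Ck X) {f \<in> cont_funs X. f ` K \<subseteq> W}"
  unfolding Ck_def using assms by (intro topology_generated_by_Basis) blast

text \<open>A subbasic set only confines the image of a compact set as a whole. Pointwise closeness
  comes from cutting \<open>K\<close> into finitely many compact pieces on which \<open>f0\<close>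
  is nearly constant, and confining the image of each piece separately.\<close>

lemma Ck_uniform_neighbourhood:
  assumes K: "compactin X K" and f0: "f0 \<in> cont_funs X" and e: "0 < e"
  obtains T where "openin (Ck X) T" "f0 \<in> T" "\<And>f y. f \<in> T \<Longrightarrow> y \<in> K \<Longrightarrow> \<bar>f y - f0 y\<bar> < e"
proof -
  have cf0: "continuous_map X euclideanreal f0"
    using f0 by (simp add: cont_funs_def)
  have "compact (f0 ` K)"
    using image_compactin[OF K cf0] by simp
  then obtain A where A: "finite A" "f0 ` K \<subseteq> (\<Union>a\<in>A. ball a (e/4))"
    using e unfolding compact_eq_totally_bounded by (meson zero_less_divide_iff zero_less_numeral)
  \<comment> \<open>Closed balls make each piece compact, and the pieces for
    \<open>a \<in> A\<close> cover \<open>K\<close>. The larger radius \<open>e/2\<close> below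
    leaves room for \<open>f0\<close> itself to lie in \<open>N a\<close>, while
    \<open>e/4 + e/2 < e\<close> gives the final estimate.\<close>
  define L where "L a = K \<inter> {y \<in> topspace X. f0 y \<in> cball a (e/4)}" for a
  have L: "compactin X (L a)" for a
    unfolding L_def
    by (intro compact_Int_closedin[OF K] closedin_continuous_map_preimage[OF cf0]) simp
  define N where "N a = {f \<in> cont_funs X. f ` L a \<subseteq> ball a (e/2)}" for a
  \<comment> \<open>The factor \<open>topspace (Ck X)\<close> keeps \<open>T\<close> open when
    \<open>A\<close> is empty, where the intersection over \<open>A\<close> is
    \<open>UNIV\<close>.\<close>
  define T where "T = topspace (Ck X) \<inter> (\<Inter>a\<in>A. N a)"
  show thesis
  proof
    show "openin (Ck X) T"
      unfolding T_def
      by (cases "A = {}")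
        (auto intro!: openin_Int openin_INT2 A(1) simp: N_def intro: openin_Ck_subbasic[OF L])
    show "f0 \<in> T"
      using f0 e by (auto simp: T_def N_def L_def topspace_Ck)
    fix f y assume f: "f \<in> T" and y: "y \<in> K"
    obtain a where a: "a \<in> A" "f0 y \<in> ball a (e/4)"
      using A y by blast
    have "y \<in> L a"
      using a y compactin_subset_topspace[OF K] by (auto simp: L_def)
    moreover have "f ` L a \<subseteq> ball a (e/2)"
      using f a by (auto simp: T_def N_def)
    ultimately have "f y \<in> ball a (e/2)"
      by blast
    with a e show "\<bar>f y - f0 y\<bar> < e"
      unfolding mem_ball dist_real_def by linarith
  qed
qed

text \<open>The restriction to \<open>topspace X\<close> makes the result extensional, as
  \<open>cont_funs X\<close> demands. The case distinction discards the arbitrary values of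
  \<open>f\<close> off \<open>U\<close>.\<close>

definition extend_by_zero :: "'a topology \<Rightarrow> 'a set \<Rightarrow> ('a \<Rightarrow> real) \<Rightarrow> ('a \<Rightarrow> real) \<Rightarrow> 'a \<Rightarrow> real" where
  "extend_by_zero X U g f = (\<lambda>y\<in>topspace X. if y \<in> U then g y * f y else 0)"

text \<open>Since \<open>F \<subseteq> U\<close>, the open sets \<open>U\<close> and
  \<open>topspace X - F\<close> cover the space. The product \<open>g y * f y\<close> on the first
  and \<open>0\<close> on the second agree on the overlap, where \<open>g\<close> vanishes, so they
  paste.\<close>

lemma extend_by_zero_in_cont_funs:
  assumes U: "openin X U" and F: "closedin X F" "F \<subseteq> U"
    and g: "continuous_map X euclideanreal g" and g0: "\<And>y. y \<in> topspace X - F \<Longrightarrow> g y = 0"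
    and f: "f \<in> cont_funs (subtopology X U)"
  shows "extend_by_zero X U g f \<in> cont_funs X"
proof -
  let ?h = "\<lambda>y. if y \<in> U then g y * f y else 0"
  have cf: "continuous_map (subtopology X U) euclideanreal f"
    using f by (simp add: cont_funs_def)
  have "continuous_map X euclideanreal ?h"
  proof (rule pasting_lemma[where I = UNIV and T = "\<lambda>b. if b then U else topspace X - F"
          and f = "\<lambda>b. if b then \<lambda>y. g y * f y else (\<lambda>y. 0)"])
    show "openin X (if b then U else topspace X - F)" for b
      using U F by auto
    show "continuous_map (subtopology X (if b then U else topspace X - F)) euclideanreal
        (if b then \<lambda>y. g y * f y else (\<lambda>y. 0))" for b
      using continuous_map_real_mult[OF continuous_map_from_subtopology[OF g, of U] cf] by simp
    show "\<exists>b. b \<in> UNIV \<and> y \<in> (if b then U else topspace X - F) \<and>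
        ?h y = (if b then \<lambda>y. g y * f y else (\<lambda>y. 0)) y" if "y \<in> topspace X" for y
      using that F by (cases "y \<in> U") (auto intro: exI[of _ True] exI[of _ False])
  qed (use g0 in \<open>auto split: if_splits\<close>)
  then have "continuous_map X euclideanreal (extend_by_zero X U g f)"
    by (rule continuous_map_eq) (simp add: extend_by_zero_def)
  then show ?thesis
    by (simp add: cont_funs_def extend_by_zero_def)
qed

text \<open>It suffices to treat preimages of subbasic sets. Because
  \<open>\<bar>g y\<bar> \<le> 1\<close> and all extensions vanish off \<open>F\<close>, closeness
  of \<open>f\<close> to \<open>f0\<close> on \<open>K \<inter> F\<close> forces closeness of their
  extensions on all of \<open>K\<close>.\<close>

lemma continuous_map_extend_by_zero:
  assumes U: "openin X U" and F: "closedin X F" "F \<subseteq> U"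
    and g: "continuous_map X euclideanreal g" and g0: "\<And>y. y \<in> topspace X - F \<Longrightarrow> g y = 0"
    and g1: "\<And>y. y \<in> topspace X \<Longrightarrow> \<bar>g y\<bar> \<le> 1"
  shows "continuous_map (Ck (subtopology X U)) (Ck X) (extend_by_zero X U g)"
proof -
  let ?R = "extend_by_zero X U g" and ?Y = "subtopology X U"
  have R: "?R f \<in> cont_funs X" if "f \<in> cont_funs ?Y" for f
    using extend_by_zero_in_cont_funs[OF U F g g0 that] .
  have nbhd: "openin (Ck ?Y) (?R -` {f \<in> cont_funs X. f ` K \<subseteq> W} \<inter> topspace (Ck ?Y))"
    if K: "compactin X K" and W: "open W" for K W
  proof (subst openin_subopen, intro ballI)
    fix f0 assume f0: "f0 \<in> ?R -` {f \<in> cont_funs X. f ` K \<subseteq> W} \<inter> topspace (Ck ?Y)"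
    have KX: "K \<subseteq> topspace X"
      using K by (rule compactin_subset_topspace)
    have f0Y: "f0 \<in> cont_funs ?Y"
      using f0 by (simp add: topspace_Ck)
    have "compact (?R f0 ` K)"
      using image_compactin[OF K] R[OF f0Y] by (force simp: cont_funs_def)
    \<comment> \<open>The compact image has a uniform margin \<open>e\<close> inside the open set
      \<open>W\<close>.\<close>
    then obtain e where e: "0 < e" "(\<Union>z\<in>?R f0 ` K. ball z e) \<subseteq> W"
      using compact_subset_open_imp_ball_epsilon_subset[of "?R f0 ` K" W] W f0 by auto
    \<comment> \<open>The closed set \<open>F\<close> is essential here: \<open>K \<inter> U\<close>
      need not be compact.\<close>
    have "compactin ?Y (K \<inter> F)"
      using compact_Int_closedin[OF K F(1)] F(2) by (auto simp: compactin_subtopology)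
    then obtain T where T: "openin (Ck ?Y) T" "f0 \<in> T"
      and near: "\<And>f y. f \<in> T \<Longrightarrow> y \<in> K \<inter> F \<Longrightarrow> \<bar>f y - f0 y\<bar> < e"
      using Ck_uniform_neighbourhood[OF _ f0Y e(1)] by metis
    have TY: "T \<subseteq> cont_funs ?Y"
      using openin_subset[OF T(1)] by (simp add: topspace_Ck)
    have "?R f y \<in> W" if f: "f \<in> T" and y: "y \<in> K" for f y
    proof -
      have "\<bar>?R f0 y - ?R f y\<bar> < e"
      proof (cases "y \<in> F")
        case True
        then have "\<bar>?R f0 y - ?R f y\<bar> = \<bar>g y\<bar> * \<bar>f y - f0 y\<bar>"
          using y KX F by (auto simp: extend_by_zero_def abs_minus_commute
              simp flip: abs_mult right_diff_distrib)
        also have "\<dots> \<le> \<bar>f y - f0 y\<bar>"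
          using g1[of y] y KX by (intro mult_left_le_one_le) auto
        also have "\<dots> < e"
          using near f y True by simp
        finally show ?thesis .
      next
        case False
        then show ?thesis
          using y KX g0[of y] e by (auto simp: extend_by_zero_def)
      qed
      then show ?thesis
        using e(2) y by (force simp: dist_real_def)
    qed
    then show "\<exists>T. openin (Ck ?Y) T \<and> f0 \<in> T \<and>
        T \<subseteq> ?R -` {f \<in> cont_funs X. f ` K \<subseteq> W} \<inter> topspace (Ck ?Y)"
      using T TY R by (intro exI[of _ T]) (auto simp: topspace_Ck)
  qed
  show ?thesis
    unfolding Ck_def[of X]
  proof (rule continuous_on_generated_topo)
    show "?R ` topspace (Ck ?Y) \<subseteq> \<Union> {{f \<in> cont_funs X. f ` K \<subseteq> W} |K W. compactin X K \<and> open W}"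
      using R topspace_Ck[of X] by (auto simp: topspace_Ck Ck_def topology_generated_by_topspace)
  qed (use nbhd in blast)
qed

text \<open>Complete regularity supplies the cutoff. The set \<open>V\<close> depends on
  \<open>x\<close> but not on \<open>f\<close>, which is what lets statements uniform in
  \<open>f\<close> pass from \<open>X\<close> to \<open>U\<close>.\<close>

lemma local_extension_operator:
  assumes X: "Tychonoff_space X" and U: "openin X U" and x: "x \<in> U"
  obtains V R where "openin X V" "x \<in> V" "V \<subseteq> U"
    "continuous_map (Ck (subtopology X U)) (Ck X) R" "\<And>f y. y \<in> V \<Longrightarrow> R f y = f y"
proof -
  have UX: "U \<subseteq> topspace X"
    using U by (rule openin_subset)
  have "closedin X (topspace X - U)" "x \<in> topspace X - (topspace X - U)"
    using U UX x by auto
  then obtain h where h: "continuous_map X (top_of_set {0..1::real}) h" "h x = 0"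
      "h ` (topspace X - U) \<subseteq> {1}"
    using X unfolding Tychonoff_space_def completely_regular_space_def by blast
  have ch: "continuous_map X euclideanreal h"
    using h(1) continuous_map_in_subtopology by blast
  \<comment> \<open>This \<open>g\<close> takes values in \<open>[0,1]\<close>, is \<open>1\<close>
    where \<open>h \<le> 1/3\<close> and \<open>0\<close> where \<open>h \<ge> 2/3\<close>. As
    \<open>h = 1\<close> off \<open>U\<close>, the closed set \<open>F\<close> still lies inside
    \<open>U\<close>.\<close>
  define g where "g y = min 1 (max 0 (2 - 3 * h y))" for y
  define F where "F = {y \<in> topspace X. h y \<in> {..2/3}}"
  define V where "V = {y \<in> topspace X. h y \<in> {..<1/3}}"
  show thesis
  proof
    show "openin X V"
      unfolding V_def by (rule openin_continuous_map_preimage[OF ch]) simp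
    show "x \<in> V"
      using x UX h by (auto simp: V_def)
    show VU: "V \<subseteq> U"
      using h(3) by (force simp: V_def)
    show "continuous_map (Ck (subtopology X U)) (Ck X) (extend_by_zero X U g)"
    proof (rule continuous_map_extend_by_zero[OF U])
      show "closedin X F"
        unfolding F_def by (rule closedin_continuous_map_preimage[OF ch]) simp
      show "F \<subseteq> U"
        using h(3) by (force simp: F_def)
      show "continuous_map X euclideanreal g"
        unfolding g_def
        by (intro continuous_map_real_min continuous_map_real_max continuous_map_diff
            continuous_map_real_mult ch) auto
    qed (auto simp: g_def F_def)
    show "extend_by_zero X U g f y = f y" if "y \<in> V" for f y
      using that VU by (auto simp: extend_by_zero_def g_def V_def)
  qed
qed

text \<open>Continuity of evaluation is local in the point. On \<open>V \<times> \<K>\<close>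
  evaluation factors as \<open>(y, f) \<mapsto> (y, R f)\<close> followed by evaluation on
  \<open>X\<close> times the compact set \<open>R\<close> applied to \<open>\<K>\<close>, and these
  local statements are pasted over \<open>U\<close>.\<close>

lemma Ascoli_space_open_subtopology:
  assumes X: "Ascoli_space X" and U: "openin X U"
  shows "Ascoli_space (subtopology X U)"
proof -
  let ?Y = "subtopology X U"
  have TX: "Tychonoff_space X"
    using X by (simp add: Ascoli_space_def)
  have UX: "U \<subseteq> topspace X"
    using U by (rule openin_subset)
  have "evenly_continuous_in ?Y \<K>" if \<K>: "compactin (Ck ?Y) \<K>" for \<K>
  proof -
    let ?S = "subtopology (Ck ?Y) \<K>"
    have \<K>_top: "topspace ?S = \<K>"
      using compactin_subset_topspace[OF \<K>] by auto
    have "\<forall>x\<in>U. \<exists>V. openin X V \<and> x \<in> V \<and> V \<subseteq> U \<and>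
        continuous_map (prod_topology (subtopology X V) ?S) euclideanreal (\<lambda>(x, f). f x)"
    proof
      fix x assume "x \<in> U"
      then obtain V R where V: "openin X V" "x \<in> V" "V \<subseteq> U"
        and R: "continuous_map (Ck ?Y) (Ck X) R" and RV: "\<And>f y. y \<in> V \<Longrightarrow> R f y = f y"
        using local_extension_operator[OF TX U] by metis
      let ?P = "prod_topology (subtopology X V) ?S"
      have "compactin (Ck X) (R ` \<K>)"
        using image_compactin[OF \<K> R] .
      then have ev: "continuous_map (prod_topology X (subtopology (Ck X) (R ` \<K>))) euclideanreal
          (\<lambda>(x, f). f x)"
        using X by (simp add: Ascoli_space_def evenly_continuous_in_def)
      have "continuous_map ?S (subtopology (Ck X) (R ` \<K>)) R"
        using R \<K>_top
        by (auto simp: continuous_map_in_subtopology intro: continuous_map_from_subtopology)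
      then have "continuous_map ?P (prod_topology X (subtopology (Ck X) (R ` \<K>)))
          (\<lambda>(y, f). (y, R f))"
        using continuous_map_prod_top[of "subtopology X V" ?S X "subtopology (Ck X) (R ` \<K>)" "\<lambda>y. y" R]
        by (auto intro: continuous_map_from_subtopology)
      from continuous_map_compose[OF this ev]
      have "continuous_map ?P euclideanreal (\<lambda>(x, f). f x)"
        by (rule continuous_map_eq) (auto simp: RV)
      with V show "\<exists>V. openin X V \<and> x \<in> V \<and> V \<subseteq> U \<and>
          continuous_map (prod_topology (subtopology X V) ?S) euclideanreal (\<lambda>(x, f). f x)"
        by blast
    qed
    then obtain V where V: "\<And>x. x \<in> U \<Longrightarrow> openin X (V x)" "\<And>x. x \<in> U \<Longrightarrow> x \<in> V x"
        "\<And>x. x \<in> U \<Longrightarrow> V x \<subseteq> U"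
      and cont: "\<And>x. x \<in> U \<Longrightarrow>
        continuous_map (prod_topology (subtopology X (V x)) ?S) euclideanreal (\<lambda>(x, f). f x)"
      by metis
    have "continuous_map (prod_topology ?Y ?S) euclideanreal (\<lambda>(x, f). f x)"
    proof (rule pasting_lemma[where I = U and T = "\<lambda>x. V x \<times> \<K>" and f = "\<lambda>_ (x, f). f x"])
      fix x assume x: "x \<in> U"
      have "openin ?S \<K>"
        using openin_topspace[of ?S] \<K>_top by simp
      moreover have "openin ?Y (V x)"
        using V x U by (simp add: openin_open_subtopology)
      ultimately show "openin (prod_topology ?Y ?S) (V x \<times> \<K>)"
        by (simp add: openin_prod_Times_iff)
      \<comment> \<open>Since \<open>V x \<subseteq> U\<close>, the set \<open>V x\<close> carries
        the same topology from \<open>U\<close> as from \<open>X\<close>.\<close>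
      have "subtopology (prod_topology ?Y ?S) (V x \<times> \<K>) = prod_topology (subtopology X (V x)) ?S"
        using V(3)[OF x]
        by (simp add: subtopology_Times subtopology_subtopology Int_absorb1)
      then show "continuous_map (subtopology (prod_topology ?Y ?S) (V x \<times> \<K>)) euclideanreal
          (\<lambda>(x, f). f x)"
        using cont[OF x] by simp
    next
      show "\<exists>j. j \<in> U \<and> p \<in> V j \<times> \<K> \<and> (case p of (x, f) \<Rightarrow> f x) = (case p of (x, f) \<Rightarrow> f x)"
        if "p \<in> topspace (prod_topology ?Y ?S)" for p
        using that V(2) by auto
    qed simp
    then show ?thesis
      by (simp add: evenly_continuous_in_def)
  qed
  then show ?thesis
    using TX by (simp add: Ascoli_space_def Tychonoff_space_subtopology)
qed

text \<open>The continuous \<open>R\<close> sends the sequence and its limit to a convergent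
  sequence in \<open>Ck X\<close>, whose equicontinuity at \<open>x\<close> is then read back on
  \<open>V\<close>.\<close>

lemma sequentially_Ascoli_space_open_subtopology:
  assumes X: "sequentially_Ascoli_space X" and U: "openin X U"
  shows "sequentially_Ascoli_space (subtopology X U)"
proof -
  let ?Y = "subtopology X U"
  have TX: "Tychonoff_space X"
    using X by (simp add: sequentially_Ascoli_space_def)
  have "equicontinuous_in ?Y (range f)"
    if f: "range f \<subseteq> cont_funs ?Y" and lim: "limitin (Ck ?Y) f l sequentially" for f l
    unfolding equicontinuous_in_def
  proof (intro ballI allI impI)
    fix x and e :: real assume "x \<in> topspace ?Y" and e: "0 < e"
    then have "x \<in> U" by simp
    then obtain V R where V: "openin X V" "x \<in> V" "V \<subseteq> U"
      and R: "continuous_map (Ck ?Y) (Ck X) R" and RV: "\<And>f y. y \<in> V \<Longrightarrow> R f y = f y"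
      using local_extension_operator[OF TX U] by metis
    have "range (R \<circ> f) \<subseteq> cont_funs X"
      using continuous_map_image_subset_topspace[OF R] f by (auto simp: topspace_Ck)
    moreover have "limitin (Ck X) (R \<circ> f) (R l) sequentially"
      using continuous_map_limit[OF R lim] .
    ultimately have "equicontinuous_in X (range (R \<circ> f))"
      using X unfolding sequentially_Ascoli_space_def by blast
    then obtain N where N: "openin X N" "x \<in> N"
      and small: "\<And>y n. y \<in> N \<Longrightarrow> \<bar>R (f n) y - R (f n) x\<bar> < e"
      using e V openin_subset[OF V(1)] unfolding equicontinuous_in_def
      by (metis comp_apply rangeI subsetD)
    \<comment> \<open>\<open>N\<close> is cut down to \<open>V\<close> because
      \<open>R (f n)\<close> is known to agree with \<open>f n\<close> only there.\<close>
    have "openin ?Y (N \<inter> V)"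
      using N V U by (auto simp: openin_open_subtopology)
    moreover have "\<bar>f n y - f n x\<bar> < e" if "y \<in> N \<inter> V" for y n
      using small[of y n] RV V that by auto
    ultimately show "\<exists>V. openin ?Y V \<and> x \<in> V \<and> (\<forall>x'\<in>V. \<forall>f\<in>range f. \<bar>f x' - f x\<bar> < e)"
      using N V by (intro exI[of _ "N \<inter> V"]) auto
  qed
  then show ?thesis
    using TX by (auto simp: sequentially_Ascoli_space_def Tychonoff_space_subtopology)
qed

theorem proposition3p4:
  fixes X :: "'a topology" and U :: "'a set"
  assumes "Tychonoff_space X" and "openin X U"
  shows "(Ascoli_space X \<longrightarrow> Ascoli_space (subtopology X U)) \<and>
    (sequentially_Ascoli_space X \<longrightarrow> sequentially_Ascoli_space (subtopology X U))"
  using assms Ascoli_space_open_subtopology sequentially_Ascoli_space_open_subtopology by blast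

end
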